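(* Let $n\ge 1$, $N\ge 2$, and assume that the potential $V$ is attractive or repulsive. Let $m_1,\dots,m_N$ be any positive masses, and let $\mathbf q=(\mathbf q_1,\dots,\mathbf q_N)\in Q$ be a configuration of $N$ points on $\mathbb S^n$ that lies in some closed hemisphere of $\mathbb S^n$ (a hemisphere containing its boundary) with at least one of the points $\mathbf q_i$ not on the boundary of that hemisphere; that is, there is $\mathbf v\in\mathbb S^n$ with $\mathbf v\cdot \mathbf q_i\ge 0$ for all $i$ and $\mathbf v\cdot\mathbf q_k>0$ for at least one $k$. Then $\mathbf q$ is not an equilibrium configuration for the masses $m_1,\dots,m_N$.
   Context: $\mathbb S^n$ is the unit sphere of $\mathbb R^{n+1}$. For points $\mathbf q_i,\mathbf q_j\in \mathbb S^n$, $d_{ij}\in[0,\pi]$ is the geodesic distance, $\cos d_{ij}=\mathbf q_i\cdot \mathbf q_j$. $G:(0,\pi)\to\mathbb R$ is a given smooth function and $Q$ is the set of configurations $\mathbf q=(\mathbf q_1,\dots,\mathbf q_N)\in(\mathbb S^n)^N$ with $d_{ij}\in(0,\pi)$ for all $i\ne j$. For positive masses $m_1,\dots,m_N$ the potential is $V(\mathbf q)=\sum_{1\le i<j\le N}m_im_jG(d_{ij})$. It is called attractive if $G'(x)>0$ for all $x\in(0,\pi)$, and repulsive if $G'(x)<0$ for all $x\in(0,\pi)$. A configuration $\mathbf q\in Q$ is an equilibrium configuration if it is a critical point of $V$ on $Q$, i.e. if $$\sum_{j=1,j\ne i}^N\frac{m_im_jG'(d_{ij})}{\sin d_{ij}}\,[\mathbf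 q_j-\cos d_{ij}\,\mathbf q_i]=0,\qquad i=1,\dots,N.$$ *)

theory Defs
  imports "HOL-Analysis.Analysis"
begin

text \<open>
  The sphere of dimension n is \<^term>\<open>sphere (0 :: real ^ 'd) 1\<close> where \<^term>\<open>CARD('d) = n + 1\<close>.
  A configuration of \<open>N\<close> points is a function \<^typ>\<open>nat \<Rightarrow> real ^ 'd\<close> of which only the values
  on \<^term>\<open>{1..N :: nat}\<close> matter; masses are treated likewise.  The function \<open>G\<close> is total, but only
  its values on the open interval from \<open>0\<close> to \<open>pi\<close> matter.
\<close>

definition gdist :: "real ^ 'd \<Rightarrow> real ^ 'd \<Rightarrow> real"
  where "gdist x y = arccos (x \<bullet> y)"

definition configs :: "nat \<Rightarrow> (nat \<Rightarrow> real ^ 'd) set"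
  where "configs N = {q. (\<forall>i\<in>{1..N}. q i \<in> sphere 0 1) \<and>
    (\<forall>i\<in>{1..N}. \<forall>j\<in>{1..N}. i \<noteq> j \<longrightarrow> gdist (q i) (q j) \<in> {0<..<pi})}"

definition smooth_on_0_pi :: "(real \<Rightarrow> real) \<Rightarrow> bool"
  where "smooth_on_0_pi G \<longleftrightarrow> (\<forall>k. (deriv ^^ k) G differentiable_on {0<..<pi})"

definition potential :: "(real \<Rightarrow> real) \<Rightarrow> (nat \<Rightarrow> real) \<Rightarrow> nat \<Rightarrow> (nat \<Rightarrow> real ^ 'd) \<Rightarrow> real"
  where "potential G m N q =
    (\<Sum>(i, j) \<in> {(i, j). 1 \<le> i \<and> i < j \<and> j \<le> N}. m i * m j * G (gdist (q i) (q j)))"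

definition attractive :: "(real \<Rightarrow> real) \<Rightarrow> bool"
  where "attractive G \<longleftrightarrow> (\<forall>x\<in>{0<..<pi}. deriv G x > 0)"

definition repulsive :: "(real \<Rightarrow> real) \<Rightarrow> bool"
  where "repulsive G \<longleftrightarrow> (\<forall>x\<in>{0<..<pi}. deriv G x < 0)"

text \<open>
  The configuration \<open>q\<close> is a critical point of the potential on the manifold \<^term>\<open>configs N\<close>:
  the differential vanishes on the tangent space at \<open>q\<close>, i.e. along every curve in
  \<^term>\<open>configs N\<close> that passes through \<open>q\<close> and is differentiable there.
\<close>

definition equilibrium_configuration ::
    "(real \<Rightarrow> real) \<Rightarrow> (nat \<Rightarrow> real) \<Rightarrow> nat \<Rightarrow> (nat \<Rightarrow> real ^ 'd) \<Rightarrow> bool"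
  where "equilibrium_configuration G m N q \<longleftrightarrow> q \<in> configs N \<and>
    (\<forall>c. c 0 = q \<longrightarrow> (\<forall>\<^sub>F t in nhds 0. c t \<in> configs N) \<longrightarrow>
       (\<forall>i\<in>{1..N}. (\<lambda>t. c t i) differentiable (at 0)) \<longrightarrow>
       ((\<lambda>t. potential G m N (c t)) has_real_derivative 0) (at 0))"

text \<open>The lemma \<open>equilibrium_configuration_iff\<close> below shows that, for smooth \<open>G\<close>, this is the
  familiar system of equations.\<close>

definition grad_term ::
    "(real \<Rightarrow> real) \<Rightarrow> (nat \<Rightarrow> real) \<Rightarrow> nat \<Rightarrow> (nat \<Rightarrow> real ^ 'd) \<Rightarrow> nat \<Rightarrow> real ^ 'd"
  where "grad_term G m N q i =
    (\<Sum>j\<in>{1..N} - {i}. (m i * m j * deriv G (gdist (q i) (q j)) / sin (gdist (q i) (q j))) *\<^sub>R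
       (q j - cos (gdist (q i) (q j)) *\<^sub>R q i))"

lemma gdist_commute: "gdist x y = gdist y x"
  by (simp add: gdist_def inner_commute)

lemma inner_sphere_bounds:
  fixes x y :: "real ^ 'd"
  assumes "x \<in> sphere 0 1" "y \<in> sphere 0 1"
  shows "- 1 \<le> x \<bullet> y" "x \<bullet> y \<le> 1"
  using Cauchy_Schwarz_ineq2[of x y] assms by auto

lemma cos_gdist:
  fixes x y :: "real ^ 'd"
  assumes "x \<in> sphere 0 1" "y \<in> sphere 0 1"
  shows "cos (gdist x y) = x \<bullet> y"
  using inner_sphere_bounds[OF assms] by (simp add: gdist_def cos_arccos)

lemma gdist_in_iff:
  fixes x y :: "real ^ 'd"
  assumes "x \<in> sphere 0 1" "y \<in> sphere 0 1"
  shows "gdist x y \<in> {0<..<pi} \<longleftrightarrow> -1 < x \<bullet> y \<and> x \<bullet> y < 1"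
proof
  assume a: "gdist x y \<in> {0<..<pi}"
  have "x \<bullet> y \<noteq> 1" "x \<bullet> y \<noteq> -1"
    using a by (auto simp: gdist_def)
  with inner_sphere_bounds[OF assms] show "-1 < x \<bullet> y \<and> x \<bullet> y < 1"
    by linarith
next
  assume a: "-1 < x \<bullet> y \<and> x \<bullet> y < 1"
  then show "gdist x y \<in> {0<..<pi}"
    using arccos_lt_bounded[of "x \<bullet> y"] by (simp add: gdist_def)
qed

lemma sum_pairs_symmetrize:
  fixes f :: "nat \<Rightarrow> nat \<Rightarrow> real"
  shows "(\<Sum>(i, j) \<in> {(i, j). 1 \<le> i \<and> i < j \<and> j \<le> N}. f i j + f j i)
       = (\<Sum>i\<in>{1..N}. \<Sum>j\<in>{1..N} - {i}. f i j)"
proof -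
  let ?A = "{(i, j). 1 \<le> i \<and> i < j \<and> j \<le> N}" and ?B = "{(i, j). 1 \<le> j \<and> j < i \<and> i \<le> N}"
  have fA: "finite ?A" by (rule finite_subset[of _ "{1..N} \<times> {1..N}"]) auto
  have fB: "finite ?B" by (rule finite_subset[of _ "{1..N} \<times> {1..N}"]) auto
  have swap: "(\<Sum>(i, j)\<in>?A. f j i) = (\<Sum>(i, j)\<in>?B. f i j)"
    by (rule sum.reindex_bij_witness[of _ prod.swap prod.swap]) auto
  have "(\<Sum>i\<in>{1..N}. \<Sum>j\<in>{1..N} - {i}. f i j) = (\<Sum>(i, j)\<in>Sigma {1..N} (\<lambda>i. {1..N} - {i}). f i j)"
    by (rule sum.Sigma) auto
  also have "Sigma {1..N} (\<lambda>i. {1..N} - {i}) = ?A \<union> ?B"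
    by auto
  also have "(\<Sum>(i, j)\<in>?A \<union> ?B. f i j) = (\<Sum>(i, j)\<in>?A. f i j) + (\<Sum>(i, j)\<in>?B. f i j)"
    by (rule sum.union_disjoint[OF fA fB]) auto
  also have "\<dots> = (\<Sum>(i, j)\<in>?A. f i j + f j i)"
    unfolding swap[symmetric] by (simp add: sum.distrib case_prod_unfold)
  finally show ?thesis by simp
qed

lemma potential_curve_derivative:
  fixes c :: "real \<Rightarrow> nat \<Rightarrow> real ^ 'd"
  assumes G: "smooth_on_0_pi G" and q: "q \<in> configs N" and c0: "c 0 = q"
    and ev: "\<forall>\<^sub>F t in nhds 0. c t \<in> configs N"
    and w: "\<And>i. i \<in> {1..N} \<Longrightarrow> ((\<lambda>t. c t i) has_vector_derivative w i) (at 0)"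
  shows "((\<lambda>t. potential G m N (c t)) has_real_derivative
           - (\<Sum>i\<in>{1..N}. w i \<bullet> grad_term G m N q i)) (at 0)"
proof -
  define a where "a i j = m i * m j * deriv G (gdist (q i) (q j)) / sin (gdist (q i) (q j))" for i j
  have asym: "a i j = a j i" for i j
    by (simp add: a_def gdist_commute[of "q i"] mult.commute)
  have sph: "q i \<in> sphere 0 1" if "i \<in> {1..N}" for i
    using q that by (auto simp: configs_def)
  have inner_deriv: "((\<lambda>t. c t i \<bullet> c t j) has_real_derivative (q i \<bullet> w j + w i \<bullet> q j)) (at 0)"
    if "i \<in> {1..N}" "j \<in> {1..N}" for i j
    using bounded_bilinear.has_vector_derivative[OF bounded_bilinear_inner w[OF that(1)] w[OF that(2)]]
    by (simp add: c0 has_real_derivative_iff_has_vector_derivative)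
  have tang: "w i \<bullet> q i = 0" if i: "i \<in> {1..N}" for i
  proof -
    have "\<forall>\<^sub>F t in nhds 0. c t i \<bullet> c t i = 1"
      using ev by eventually_elim (use i in \<open>auto simp: configs_def dot_square_norm\<close>)
    then have "((\<lambda>t. c t i \<bullet> c t i) has_real_derivative 0) (at 0)"
      by (subst DERIV_cong_ev[OF refl _ refl]) auto
    from DERIV_unique[OF this inner_deriv[OF i i]] show ?thesis
      by (simp add: inner_commute)
  qed
  have term_deriv: "((\<lambda>t. m i * m j * G (gdist (c t i) (c t j))) has_real_derivative
       - (a i j * (w i \<bullet> q j)) + - (a j i * (w j \<bullet> q i))) (at 0)"
    if i: "i \<in> {1..N}" and j: "j \<in> {1..N}" and ij: "i \<noteq> j" for i j
  proof -
    let ?d = "gdist (q i) (q j)"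
    have d: "?d \<in> {0<..<pi}" using q i j ij by (auto simp: configs_def)
    have b: "-1 < q i \<bullet> q j" "q i \<bullet> q j < 1"
      using gdist_in_iff[OF sph[OF i] sph[OF j]] d by auto
    have sn: "sqrt (1 - (q i \<bullet> q j)\<^sup>2) = sin ?d"
      unfolding gdist_def using b by (simp add: sin_arccos)
    have "G differentiable (at ?d)"
      using G[unfolded smooth_on_0_pi_def, rule_format, of 0] d
        differentiable_on_eq_differentiable_at[of "{0<..<pi}" G] by auto
    then have GD: "(G has_real_derivative deriv G ?d) (at ?d)"
      by (metis DERIV_deriv_iff_real_differentiable)
    have AD: "((\<lambda>t. gdist (c t i) (c t j)) has_real_derivative
        inverse (- sin ?d) * (q i \<bullet> w j + w i \<bullet> q j)) (at 0)"
      unfolding gdist_def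
      using DERIV_chain2[OF DERIV_arccos[of "c 0 i \<bullet> c 0 j"] inner_deriv[OF i j]] b sn
      by (simp add: c0 gdist_def)
    have "((\<lambda>t. G (gdist (c t i) (c t j))) has_real_derivative
        deriv G ?d * (inverse (- sin ?d) * (q i \<bullet> w j + w i \<bullet> q j))) (at 0)"
      by (rule DERIV_chain2[OF _ AD]) (use GD in \<open>simp add: c0\<close>)
    from DERIV_cmult[OF this, of "m i * m j"]
    have "((\<lambda>t. m i * m j * G (gdist (c t i) (c t j))) has_real_derivative
        m i * m j * (deriv G ?d * (inverse (- sin ?d) * (q i \<bullet> w j + w i \<bullet> q j)))) (at 0)" .
    moreover have "m i * m j * (deriv G ?d * (inverse (- sin ?d) * (q i \<bullet> w j + w i \<bullet> q j)))
        = - (a i j * (w i \<bullet> q j)) + - (a j i * (w j \<bullet> q i))"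
      unfolding asym[of j i] by (simp add: a_def inner_commute field_simps add_divide_distrib)
    ultimately show ?thesis by simp
  qed
  have "((\<lambda>t. potential G m N (c t)) has_real_derivative
     (\<Sum>(i, j) \<in> {(i, j). 1 \<le> i \<and> i < j \<and> j \<le> N}.
        - (a i j * (w i \<bullet> q j)) + - (a j i * (w j \<bullet> q i)))) (at 0)"
    unfolding potential_def case_prod_unfold
    by (rule DERIV_sum) (use term_deriv in auto)
  also have "(\<Sum>(i, j) \<in> {(i, j). 1 \<le> i \<and> i < j \<and> j \<le> N}.
        - (a i j * (w i \<bullet> q j)) + - (a j i * (w j \<bullet> q i)))
     = (\<Sum>i\<in>{1..N}. \<Sum>j\<in>{1..N} - {i}. - (a i j * (w i \<bullet> q j)))"
    by (rule sum_pairs_symmetrize)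
  also have "\<dots> = (\<Sum>i\<in>{1..N}. - (w i \<bullet> grad_term G m N q i))"
    by (rule sum.cong[OF refl])
      (simp add: grad_term_def a_def[symmetric] inner_sum_right inner_diff_right tang sum_negf)
  finally show ?thesis by (simp add: sum_negf)
qed

lemma grad_term_tangent:
  assumes q: "q \<in> configs N" and i: "i \<in> {1..N}"
  shows "q i \<bullet> grad_term G m N q i = 0"
proof -
  have sph: "q k \<in> sphere 0 1" if "k \<in> {1..N}" for k
    using q that by (auto simp: configs_def)
  have "q i \<bullet> q i = 1" using sph[OF i] by (simp add: dot_square_norm)
  then show ?thesis
    by (auto simp: grad_term_def inner_sum_right inner_diff_right cos_gdist[OF sph[OF i] sph]
        intro!: sum.neutral)
qed

lemma equilibrium_configuration_iff:
  fixes q :: "nat \<Rightarrow> real ^ 'd"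
  assumes G: "smooth_on_0_pi G"
  shows "equilibrium_configuration G m N q \<longleftrightarrow> q \<in> configs N \<and>
    (\<forall>i\<in>{1..N}. (\<Sum>j\<in>{1..N} - {i}.
       (m i * m j * deriv G (gdist (q i) (q j)) / sin (gdist (q i) (q j))) *\<^sub>R
       (q j - cos (gdist (q i) (q j)) *\<^sub>R q i)) = 0)"
    (is "_ \<longleftrightarrow> _ \<and> ?eqs")
proof -
  have eqs: "?eqs \<longleftrightarrow> (\<forall>i\<in>{1..N}. grad_term G m N q i = 0)"
    by (simp add: grad_term_def)
  have "equilibrium_configuration G m N q" if q: "q \<in> configs N"
    and F: "\<forall>i\<in>{1..N}. grad_term G m N q i = 0"
    unfolding equilibrium_configuration_def
  proof (intro conjI allI impI q)
    fix c :: "real \<Rightarrow> nat \<Rightarrow> real ^ 'd"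
    assume c: "c 0 = q" "\<forall>\<^sub>F t in nhds 0. c t \<in> configs N"
      "\<forall>i\<in>{1..N}. (\<lambda>t. c t i) differentiable at 0"
    have "((\<lambda>t. c t i) has_vector_derivative vector_derivative (\<lambda>t. c t i) (at 0)) (at 0)"
      if "i \<in> {1..N}" for i
      using c(3) that vector_derivative_works by blast
    from potential_curve_derivative[OF G q c(1,2) this, of m]
    show "((\<lambda>t. potential G m N (c t)) has_real_derivative 0) (at 0)"
      using F by simp
  qed
  moreover have "grad_term G m N q i = 0"
    if E: "equilibrium_configuration G m N q" and i: "i \<in> {1..N}" for i
  proof (rule ccontr)
    let ?F = "grad_term G m N q i"
    assume nz: "?F \<noteq> 0"
    have q: "q \<in> configs N" using E by (simp add: equilibrium_configuration_def)
    have sph: "q k \<in> sphere 0 1" if "k \<in> {1..N}" for k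
      using q that by (auto simp: configs_def)
    define u where "u = ?F /\<^sub>R norm ?F"
    have u1: "u \<bullet> u = 1" using nz by (simp add: u_def dot_square_norm power2_eq_square)
    have uq: "q i \<bullet> u = 0" using grad_term_tangent[OF q i] by (simp add: u_def)
    have qq: "q i \<bullet> q i = 1" using sph[OF i] by (simp add: dot_square_norm)
    define c where "c t = q (i := cos t *\<^sub>R q i + sin t *\<^sub>R u)" for t :: real
    have c0: "c 0 = q" by (simp add: c_def)
    have csph: "c t k \<in> sphere 0 1" if "k \<in> {1..N}" for t k
    proof -
      have "(cos t *\<^sub>R q i + sin t *\<^sub>R u) \<bullet> (cos t *\<^sub>R q i + sin t *\<^sub>R u) = (cos t)\<^sup>2 + (sin t)\<^sup>2"
        using qq u1 uq inner_commute[of u "q i"]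
        by (simp add: inner_add_left inner_add_right power2_eq_square)
      then have "norm (cos t *\<^sub>R q i + sin t *\<^sub>R u) = 1"
        by (simp add: norm_eq_sqrt_inner)
      then show ?thesis using sph[OF that] by (auto simp: c_def)
    qed
    have cont: "isCont (\<lambda>t. c t k) 0" for k
      by (cases "k = i") (auto simp: c_def intro!: continuous_intros)
    have "\<forall>\<^sub>F t in nhds 0. -1 < c t k \<bullet> c t l \<and> c t k \<bullet> c t l < 1"
      if kl: "k \<in> {1..N}" "l \<in> {1..N}" "k \<noteq> l" for k l
    proof -
      have b: "-1 < q k \<bullet> q l" "q k \<bullet> q l < 1"
        using gdist_in_iff[OF sph[OF kl(1)] sph[OF kl(2)]] q kl by (auto simp: configs_def)
      have "isCont (\<lambda>t. c t k \<bullet> c t l) 0"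
        by (intro continuous_intros cont)
      then have l: "((\<lambda>t. c t k \<bullet> c t l) \<longlongrightarrow> q k \<bullet> q l) (nhds 0)"
        using tendsto_at_iff_tendsto_nhds[of "\<lambda>t. c t k \<bullet> c t l" 0]
        by (simp add: continuous_at c0)
      show ?thesis
        using order_tendstoD(1)[OF l b(1)] order_tendstoD(2)[OF l b(2)] by eventually_elim auto
    qed
    then have "\<forall>\<^sub>F t in nhds 0. \<forall>k\<in>{1..N}. \<forall>l\<in>{1..N}. k \<noteq> l \<longrightarrow>
        -1 < c t k \<bullet> c t l \<and> c t k \<bullet> c t l < 1"
      by (simp add: eventually_ball_finite_distrib)
    then have ev: "\<forall>\<^sub>F t in nhds 0. c t \<in> configs N"
    proof eventually_elim
      case (elim t)
      then show ?case
        unfolding configs_def using csph[of _ t] gdist_in_iff[OF csph[of _ t] csph[of _ t]] by blast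
    qed
    define w where "w k = (if k = i then u else 0)" for k
    have w: "((\<lambda>t. c t k) has_vector_derivative w k) (at 0)" for k
      by (cases "k = i")
        (auto simp: c_def w_def has_vector_derivative_def
          intro!: derivative_eq_intros)
    have "((\<lambda>t. potential G m N (c t)) has_real_derivative 0) (at 0)"
      using E c0 ev w unfolding equilibrium_configuration_def
      by (blast intro: differentiableI_vector)
    from DERIV_unique[OF this potential_curve_derivative[OF G q c0 ev w]]
    have "(\<Sum>k\<in>{1..N}. w k \<bullet> grad_term G m N q k) = 0" by simp
    also have "(\<Sum>k\<in>{1..N}. w k \<bullet> grad_term G m N q k)
        = (\<Sum>k\<in>{1..N}. if k = i then u \<bullet> ?F else 0)"
      by (rule sum.cong) (auto simp: w_def)
    also have "\<dots> = u \<bullet> ?F" using i by simp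
    also have "\<dots> = norm ?F"
      using nz by (simp add: u_def dot_square_norm power2_eq_square)
    finally show False using nz by simp
  qed
  ultimately show ?thesis
    unfolding eqs by (auto simp: equilibrium_configuration_def)
qed

end

theory Submission
  imports Defs
begin

text \<open>
  Project the equilibrium equation of a point \<open>q i\<close> of minimal height \<open>v \<bullet> q i\<close> onto \<open>v\<close>.  All its
  coefficients have the same sign, and every factor \<open>v \<bullet> q j - cos (gdist (q i) (q j)) * (v \<bullet> q i)\<close>
  is nonnegative by minimality, so all of them vanish.  Since the cosines are less than \<open>1\<close>, this
  forces \<open>v \<bullet> q i = 0\<close>, and then \<open>v \<bullet> q j = 0\<close> for all \<open>j\<close>.
\<close>

theorem theorem1:
  fixes n N :: nat
    and G :: "real \<Rightarrow> real"
    and m :: "nat \<Rightarrow> real"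
    and q :: "nat \<Rightarrow> real ^ 'd"
    and v :: "real ^ 'd"
  assumes "CARD('d) = n + 1" and "n \<ge> 1" and "N \<ge> 2"
    and "smooth_on_0_pi G"
    and "attractive G \<or> repulsive G"
    and "\<forall>i\<in>{1..N}. m i > 0"
    and "q \<in> configs N"
    and "v \<in> sphere 0 1"
    and "\<forall>i\<in>{1..N}. v \<bullet> q i \<ge> 0"
    and "\<exists>k\<in>{1..N}. v \<bullet> q k > 0"
  shows "\<not> equilibrium_configuration G m N q"
proof
  assume "equilibrium_configuration G m N q"
  then have eq: "grad_term G m N q i = 0" if "i \<in> {1..N}" for i
    using that equilibrium_configuration_iff[OF assms(4), of m N q] unfolding grad_term_def by blast
  obtain i where i: "i \<in> {1..N}" and min: "\<And>j. j \<in> {1..N} \<Longrightarrow> v \<bullet> q i \<le> v \<bullet> q j"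
    using arg_min_if_finite(1)[of "{1..N}" "\<lambda>j. v \<bullet> q j"]
      arg_min_least[of "{1..N}" _ "\<lambda>j. v \<bullet> q j"] \<open>N \<ge> 2\<close> by fastforce
  \<comment> \<open>The sign \<open>s\<close> is 1 for attraction and -1 for repulsion, so that both
    cases run through one argument.\<close>
  obtain s :: real where s: "\<And>x. x \<in> {0<..<pi} \<Longrightarrow> s * deriv G x > 0"
  proof (cases "attractive G")
    case True
    then show ?thesis using that[of 1] by (simp add: attractive_def)
  next
    case False
    then show ?thesis using assms(5) that[of "-1"] by (simp add: repulsive_def)
  qed
  define d where "d j = gdist (q i) (q j)" for j
  \<comment> \<open>For \<open>j\<close> other than \<open>i\<close>, \<open>h j\<close> is the
    component along \<open>v\<close> of the vector in the \<open>j\<close>-th summand of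
    \<open>grad_term G m N q i\<close>, and \<open>a j\<close> is its coefficient.\<close>
  define h where "h j = v \<bullet> q j - cos (d j) * (v \<bullet> q i)" for j
  define a where "a j = m i * m j * deriv G (d j) / sin (d j)" for j
  have d: "d j \<in> {0<..<pi}" if "j \<in> {1..N} - {i}" for j
    using \<open>q \<in> configs N\<close> i that by (auto simp: configs_def d_def)
  have cos_less: "cos (d j) < 1" if "j \<in> {1..N} - {i}" for j
    using d[OF that] cos_monotone_0_pi[of 0 "d j"] by simp
  have a_pos: "s * a j > 0" if j: "j \<in> {1..N} - {i}" for j
  proof -
    have "m i * m j > 0" "sin (d j) > 0"
      using assms(6) i j d[OF j] by (auto intro: sin_gt_zero)
    then have "m i * m j * (s * deriv G (d j)) / sin (d j) > 0"
      using s[OF d[OF j]] by simp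
    then show ?thesis by (simp add: a_def algebra_simps)
  qed
  \<comment> \<open>Keeping the factor \<open>1 - cos (d j)\<close> serves twice: it gives
    \<open>h j\<close> \<ge> 0, and once \<open>h j = 0\<close> it bounds the minimal height from
    above.\<close>
  have h_ge: "h j \<ge> (1 - cos (d j)) * (v \<bullet> q i)" if "j \<in> {1..N}" for j
    using min[OF that] by (simp add: h_def algebra_simps)
  have h_nonneg: "h j \<ge> 0" if "j \<in> {1..N}" for j
    by (rule order_trans[OF _ h_ge[OF that]]) (use assms(9) i in simp)
  have "(\<Sum>j\<in>{1..N} - {i}. s * a j * h j) = s * (v \<bullet> grad_term G m N q i)"
    by (simp add: grad_term_def a_def d_def h_def inner_sum_right inner_diff_right
        sum_distrib_left mult.assoc)
  also have "\<dots> = 0"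
    using eq[OF i] by simp
  finally have sum_zero: "(\<Sum>j\<in>{1..N} - {i}. s * a j * h j) = 0" .
  have "s * a j * h j \<ge> 0" if "j \<in> {1..N} - {i}" for j
    using a_pos[OF that] h_nonneg[of j] that by (auto intro!: mult_nonneg_nonneg[of "s * a j"])
  then have "\<forall>j\<in>{1..N} - {i}. s * a j * h j = 0"
    using sum_zero sum_nonneg_eq_0_iff[of "{1..N} - {i}" "\<lambda>j. s * a j * h j"] by blast
  then have h_zero: "h j = 0" if "j \<in> {1..N} - {i}" for j
    using a_pos[OF that] that by force
  have "v \<bullet> q i = 0"
  proof -
    \<comment> \<open>The strict bound \<open>cos (d j) < 1\<close> concerns only indices other than
      \<open>i\<close>; \<open>N \<ge> 2\<close> supplies one.\<close>
    obtain j where j: "j \<in> {1..N} - {i}"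
    proof (cases "i = 1")
      case True
      then show ?thesis using that[of 2] \<open>N \<ge> 2\<close> by simp
    next
      case False
      then show ?thesis using that[of 1] \<open>N \<ge> 2\<close> by simp
    qed
    then have "(1 - cos (d j)) * (v \<bullet> q i) \<le> 0"
      using h_ge[of j] h_zero[OF j] by simp
    moreover have "v \<bullet> q i \<ge> 0"
      using assms(9) i by simp
    ultimately show ?thesis
      using cos_less[OF j] by (simp add: mult_le_0_iff)
  qed
  \<comment> \<open>At height zero of \<open>q i\<close> the cosine term drops out, so
    \<open>h j\<close> is just the height of \<open>q j\<close>.\<close>
  then have "v \<bullet> q j = 0" if "j \<in> {1..N}" for j
    using h_zero[of j] that by (cases "j = i") (auto simp: h_def)
  with assms(10) show False
    by force
qed

end
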